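(* Let $E$ be a JB$^*$-triple and let $e,u$ be two tripotents in $E$. Then the following implications hold: $$u\le e\Rightarrow u\le_re\Rightarrow u\le_ce,\qquad u\le_he\Rightarrow u\le_{hc}e\Rightarrow u\le_ne,\qquad u\le_{h,t}e\Rightarrow u\le_{hc,t}e\Rightarrow u\le_{n,t}e\Rightarrow u\le_2e,$$ $$u\le_re\Rightarrow u\le_he,\quad u\le_ce\Rightarrow u\le_{hc}e,\quad u\le_he\Rightarrow u\le_{h,t}e,\quad u\le_{hc}e\Rightarrow u\le_{hc,t}e,\quad u\le_ne\Rightarrow u\le_{n,t}e.$$ Moreover, if $E$ is a JB$^*$-algebra and $e,u\in E$ are projections, then all the relations $u\le e$, $u\le_re$, $u\le_ce$, $u\le_he$, $u\le_{hc}e$, $u\le_ne$, $u\le_{h,t}e$, $u\le_{hc,t}e$, $u\le_{n,t}e$, $u\le_2e$ are equivalent.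
   Context: A JB$^*$-triple is a complex Banach space $E$ with a continuous map $\{\cdot,\cdot,\cdot\}:E^3\to E$ (triple product), symmetric and bilinear in the outer variables and conjugate linear in the middle one, such that (a) $\{x,y,\{a,b,c\}\}=\{\{x,y,a\},b,c\}-\{a,\{y,x,b\},c\}+\{a,b,\{x,y,c\}\}$; (b) for each $a\in E$ the operator $x\mapsto\{a,a,x\}$ is hermitian (i.e. $\|e^{i\alpha T}\|=1$ for all $\alpha\in\mathbb R$) with non-negative spectrum; (c) $\|\{x,x,x\}\|=\|x\|^3$. A JB$^*$-algebra $(B,\circ,* )$ is a JB$^*$-triple with $\{x,y,z\}=(x\circ y^* )\circ z+x\circ(y^*\circ z)-(x\circ z)\circ y^*$; a projection in it is $p$ with $p=p^*=p\circ p$. A tripotent is $e\in E$ with $\{e,e,e\}=e$. Put $E_2(e)=\{x\in E:\{e,e,x\}=x\}$. Tripotents $e,u$ are orthogonal if $\{e,u,x\}=0$ for all $x\in E$. A complex unit is $\alpha\in\mathbb C$ with $|\alpha|=1$. For tripotents $u,e$: - $u\le e$ iff $e-u$ is a tripotent orthogonal to $u$; - $u\le_r e$ iff $u\le e$ or $-u\le e$; - $u\le_c e$ iff $\alpha u\le e$ for some complex unit $\alpha$; - $u\le_h e$ iff $u=\{e,u,e\}$; - $u\le_{hc}e$ iff $\alpha u\le_h e$ for some complex unit $\alpha$; - $u\le_n e$ iff $u=\{e,e,u\}$ and $\{u,u,e\}$ is a tripotent; - $u\le_2 e$ iff $u\in E_2(e)$; - for $\kappa\in\{h,hc,n\}$,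 $u\le_{\kappa,t}e$ iff there are tripotents $e=v_0,\dots,v_k=u$ in $E$ with $v_j\le_\kappa v_{j-1}$ for $j=1,\dots,k$. *)

theory Defs
  imports "HOL-Analysis.Analysis"
begin

text \<open>
  A complex Banach space is carried by a real Banach type together with a complex scalar
  multiplication that extends the real one and is compatible with the norm.
\<close>

locale complex_banach_space = vector_space cscale
  for cscale :: "complex \<Rightarrow> 'a::banach \<Rightarrow> 'a" +
  assumes scale_of_real: "cscale (complex_of_real r) x = r *\<^sub>R x"
    and norm_scale: "norm (cscale c x) = cmod c * norm x"

text \<open>
  The operator exponential \<open>exp A = (\<Sum>n. A\<^sup>n / n!)\<close>, evaluated pointwise; for bounded \<open>A\<close> the
  series converges in operator norm, so this is the usual exponential. (The type of bounded
  linear operators is not an instance of the Banach algebra classes on which \<open>exp\<close> is defined.)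
\<close>

definition op_exp :: "('a::real_normed_vector \<Rightarrow> 'a) \<Rightarrow> 'a \<Rightarrow> 'a" where
  "op_exp A x = (\<Sum>n. (A ^^ n) x /\<^sub>R fact n)"

definition hermitian_op :: "(complex \<Rightarrow> 'a::real_normed_vector \<Rightarrow> 'a) \<Rightarrow> ('a \<Rightarrow> 'a) \<Rightarrow> bool" where
  "hermitian_op cscale A \<longleftrightarrow>
     (\<forall>\<alpha>::real. onorm (op_exp (\<lambda>x. cscale (\<i> * complex_of_real \<alpha>) (A x))) = 1)"

text \<open>The spectrum in the algebra of bounded complex-linear operators.\<close>

definition op_spectrum :: "(complex \<Rightarrow> 'a::real_normed_vector \<Rightarrow> 'a) \<Rightarrow> ('a \<Rightarrow> 'a) \<Rightarrow> complex set" where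
  "op_spectrum cscale A =
     {l. \<not> (\<exists>S. bounded_linear S \<and> Vector_Spaces.linear cscale cscale S \<and>
               (\<forall>x. S (cscale l x - A x) = x) \<and> (\<forall>x. cscale l (S x) - A (S x) = x))}"

locale jbstar_triple = complex_banach_space cscale
  for cscale :: "complex \<Rightarrow> 'a::banach \<Rightarrow> 'a" +
  fixes triple :: "'a \<Rightarrow> 'a \<Rightarrow> 'a \<Rightarrow> 'a"
  assumes triple_continuous: "continuous_on UNIV (\<lambda>(x, y, z). triple x y z)"
    and triple_sym: "triple x y z = triple z y x"
    and triple_linear: "Vector_Spaces.linear cscale cscale (\<lambda>x. triple x y z)"
    and triple_add_middle: "triple x (y + y') z = triple x y z + triple x y' z"
    and triple_scale_middle: "triple x (cscale \<gamma> y) z = cscale (cnj \<gamma>) (triple x y z)"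
    and jordan_identity:
      "triple x y (triple a b c) =
         triple (triple x y a) b c - triple a (triple y x b) c + triple a b (triple x y c)"
    and triple_hermitian: "hermitian_op cscale (\<lambda>x. triple a a x)"
    and triple_spectrum: "op_spectrum cscale (\<lambda>x. triple a a x) \<subseteq> \<real>\<^sub>\<ge>\<^sub>0"
    and triple_norm: "norm (triple x x x) = norm x ^ 3"

definition jordan_triple ::
  "('a \<Rightarrow> 'a \<Rightarrow> 'a) \<Rightarrow> ('a \<Rightarrow> 'a) \<Rightarrow> 'a \<Rightarrow> 'a \<Rightarrow> 'a \<Rightarrow> 'a::ab_group_add" where
  "jordan_triple jmult star x y z =
     jmult (jmult x (star y)) z + jmult x (jmult (star y) z) - jmult (jmult x z) (star y)"

text \<open>
  JB*-algebras: complex Jordan--Banach algebras with an involution. The last axiom is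
  \<open>\<parallel>U\<^sub>x(x\<^sup>*)\<parallel> = \<parallel>x\<parallel>\<^sup>3\<close>, since \<open>U\<^sub>x(y\<^sup>*) = {x, y, x}\<close>.
\<close>

locale jbstar_algebra = complex_banach_space cscale
  for cscale :: "complex \<Rightarrow> 'a::banach \<Rightarrow> 'a" +
  fixes jmult :: "'a \<Rightarrow> 'a \<Rightarrow> 'a"
    and star :: "'a \<Rightarrow> 'a"
  assumes jmult_commute: "jmult x y = jmult y x"
    and jmult_linear: "Vector_Spaces.linear cscale cscale (\<lambda>x. jmult x y)"
    and jmult_jordan: "jmult (jmult x y) (jmult x x) = jmult x (jmult y (jmult x x))"
    and norm_jmult: "norm (jmult x y) \<le> norm x * norm y"
    and star_add: "star (x + y) = star x + star y"
    and star_scale: "star (cscale c x) = cscale (cnj c) (star x)"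
    and star_star: "star (star x) = x"
    and star_jmult: "star (jmult x y) = jmult (star y) (star x)"
    and norm_jordan_triple: "norm (jordan_triple jmult star x x x) = norm x ^ 3"

definition jprojection :: "('a \<Rightarrow> 'a \<Rightarrow> 'a) \<Rightarrow> ('a \<Rightarrow> 'a) \<Rightarrow> 'a \<Rightarrow> bool" where
  "jprojection jmult star p \<longleftrightarrow> p = star p \<and> p = jmult p p"

definition tripotent :: "('a \<Rightarrow> 'a \<Rightarrow> 'a \<Rightarrow> 'a) \<Rightarrow> 'a \<Rightarrow> bool" where
  "tripotent T e \<longleftrightarrow> T e e e = e"

definition peirce2 :: "('a \<Rightarrow> 'a \<Rightarrow> 'a \<Rightarrow> 'a) \<Rightarrow> 'a \<Rightarrow> 'a set" where
  "peirce2 T e = {x. T e e x = x}"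

definition tri_orthogonal :: "('a \<Rightarrow> 'a \<Rightarrow> 'a \<Rightarrow> 'a::zero) \<Rightarrow> 'a \<Rightarrow> 'a \<Rightarrow> bool" where
  "tri_orthogonal T e u \<longleftrightarrow> (\<forall>x. T e u x = 0)"

text \<open>
  The relations below are meant for tripotents; in each of them the argument order is that
  of \<open>u \<le> e\<close>.
\<close>

definition tri_le :: "('a \<Rightarrow> 'a \<Rightarrow> 'a \<Rightarrow> 'a::ab_group_add) \<Rightarrow> 'a \<Rightarrow> 'a \<Rightarrow> bool" where
  "tri_le T u e \<longleftrightarrow> tripotent T (e - u) \<and> tri_orthogonal T (e - u) u"

definition tri_le_r :: "('a \<Rightarrow> 'a \<Rightarrow> 'a \<Rightarrow> 'a::ab_group_add) \<Rightarrow> 'a \<Rightarrow> 'a \<Rightarrow> bool" where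
  "tri_le_r T u e \<longleftrightarrow> tri_le T u e \<or> tri_le T (- u) e"

definition tri_le_c ::
  "(complex \<Rightarrow> 'a \<Rightarrow> 'a) \<Rightarrow> ('a \<Rightarrow> 'a \<Rightarrow> 'a \<Rightarrow> 'a::ab_group_add) \<Rightarrow> 'a \<Rightarrow> 'a \<Rightarrow> bool" where
  "tri_le_c cscale T u e \<longleftrightarrow> (\<exists>\<alpha>. cmod \<alpha> = 1 \<and> tri_le T (cscale \<alpha> u) e)"

definition tri_le_h :: "('a \<Rightarrow> 'a \<Rightarrow> 'a \<Rightarrow> 'a) \<Rightarrow> 'a \<Rightarrow> 'a \<Rightarrow> bool" where
  "tri_le_h T u e \<longleftrightarrow> u = T e u e"

definition tri_le_hc ::
  "(complex \<Rightarrow> 'a \<Rightarrow> 'a) \<Rightarrow> ('a \<Rightarrow> 'a \<Rightarrow> 'a \<Rightarrow> 'a) \<Rightarrow> 'a \<Rightarrow> 'a \<Rightarrow> bool" where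
  "tri_le_hc cscale T u e \<longleftrightarrow> (\<exists>\<alpha>. cmod \<alpha> = 1 \<and> tri_le_h T (cscale \<alpha> u) e)"

definition tri_le_n :: "('a \<Rightarrow> 'a \<Rightarrow> 'a \<Rightarrow> 'a) \<Rightarrow> 'a \<Rightarrow> 'a \<Rightarrow> bool" where
  "tri_le_n T u e \<longleftrightarrow> u = T e e u \<and> tripotent T (T u u e)"

definition tri_le_2 :: "('a \<Rightarrow> 'a \<Rightarrow> 'a \<Rightarrow> 'a) \<Rightarrow> 'a \<Rightarrow> 'a \<Rightarrow> bool" where
  "tri_le_2 T u e \<longleftrightarrow> u \<in> peirce2 T e"

text \<open>Transitive version of a relation \<open>R\<close>: all members of the chain have to be tripotents.\<close>

definition tri_chain ::
  "('a \<Rightarrow> 'a \<Rightarrow> 'a \<Rightarrow> 'a) \<Rightarrow> ('a \<Rightarrow> 'a \<Rightarrow> bool) \<Rightarrow> 'a \<Rightarrow> 'a \<Rightarrow> bool" where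
  "tri_chain T R u e \<longleftrightarrow>
     (\<exists>(k::nat) v. v 0 = e \<and> v k = u \<and> (\<forall>j\<le>k. tripotent T (v j)) \<and>
                   (\<forall>j\<in>{1..k}. R (v j) (v (j - 1))))"

definition tri_le_ht :: "('a \<Rightarrow> 'a \<Rightarrow> 'a \<Rightarrow> 'a) \<Rightarrow> 'a \<Rightarrow> 'a \<Rightarrow> bool" where
  "tri_le_ht T = tri_chain T (tri_le_h T)"

definition tri_le_hct ::
  "(complex \<Rightarrow> 'a \<Rightarrow> 'a) \<Rightarrow> ('a \<Rightarrow> 'a \<Rightarrow> 'a \<Rightarrow> 'a) \<Rightarrow> 'a \<Rightarrow> 'a \<Rightarrow> bool" where
  "tri_le_hct cscale T = tri_chain T (tri_le_hc cscale T)"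

definition tri_le_nt :: "('a \<Rightarrow> 'a \<Rightarrow> 'a \<Rightarrow> 'a) \<Rightarrow> 'a \<Rightarrow> 'a \<Rightarrow> bool" where
  "tri_le_nt T = tri_chain T (tri_le_n T)"

end

theory Submission
  imports Defs
begin

text \<open>
  The argument is algebraic. Writing \<open>D = {e, e, _}\<close> and \<open>Q = {e, _, e}\<close> for a
  tripotent \<open>e\<close>, the Jordan identity yields \<open>DQ = Q\<close> and \<open>Q\<^sup>2 = 2D\<^sup>2 - D\<close>, hence
  \<open>D(D - 1)(2D - 1) = 0\<close>. If \<open>{e, e, v} = v\<close>, then \<open>D\<close> maps \<open>{v, x, v}\<close> to \<open>{v, (2 - D) x, v}\<close>;
  since \<open>1\<close> is the only common root of the polynomials \<open>t(t - 1)(2t - 1)\<close> and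
  \<open>(2 - t)(1 - t)(3 - 2t)\<close>, the range of \<open>{v, _, v}\<close> lies in the Peirce space of \<open>e\<close>, and
  \<open>\<le>\<^sub>2\<close> is transitive. If \<open>w\<close> is a tripotent with \<open>{e, w, e} = w\<close>, then \<open>{w, w, e} = {w, e, w}\<close>
  plays the role of the projection \<open>w\<^sup>2\<close>, and is a tripotent by repeated use of the Jordan identity.
  For projections \<open>u \<le>\<^sub>2 e\<close> means \<open>e \<circ> u = u\<close>; the linearised Jordan axiom then shows that
  multiplication by \<open>u\<close> commutes with multiplication by \<open>e - u\<close>, which is the orthogonality needed
  for \<open>u \<le> e\<close>.
\<close>

section \<open>Jordan triple systems\<close>

text \<open>Norm-free core of a JB*-triple: everything proved here applies equally to the triple
  product of a JB*-algebra, where no analytic axiom then has to be verified.\<close>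

locale jordan_triple_system = vector_space cscale
  for cscale :: "complex \<Rightarrow> 'a::ab_group_add \<Rightarrow> 'a" +
  fixes triple :: "'a \<Rightarrow> 'a \<Rightarrow> 'a \<Rightarrow> 'a"
  assumes triple_commute: "triple x y z = triple z y x"
    and linear_triple: "Vector_Spaces.linear cscale cscale (\<lambda>x. triple x y z)"
    and add_middle: "triple x (y + y') z = triple x y z + triple x y' z"
    and scale_middle: "triple x (cscale \<gamma> y) z = cscale (cnj \<gamma>) (triple x y z)"
    and main_identity:
      "triple x y (triple a b c) =
         triple (triple x y a) b c - triple a (triple y x b) c + triple a b (triple x y c)"
begin

lemma add_left: "triple (x + x') y z = triple x y z + triple x' y z"
  using linear_triple[of y z] by (simp add: Vector_Spaces.linear_iff)

lemma scale_left: "triple (cscale c x) y z = cscale c (triple x y z)"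
  using linear_triple[of y z] by (simp add: Vector_Spaces.linear_iff)

lemma add_right: "triple x y (z + z') = triple x y z + triple x y z'"
  by (metis add_left triple_commute)

lemma scale_right: "triple x y (cscale c z) = cscale c (triple x y z)"
  by (metis scale_left triple_commute)

lemma zero_left: "triple 0 y z = 0"
  using add_left[of 0 0 y z] by simp

lemma zero_middle: "triple x 0 z = 0"
  using add_middle[of x 0 0 z] by simp

lemma zero_right: "triple x y 0 = 0"
  using add_right[of x y 0 0] by simp

lemma minus_left: "triple (- x) y z = - triple x y z"
  using add_left[of x "- x" y z] by (simp add: zero_left eq_neg_iff_add_eq_0 add.commute)

lemma minus_middle: "triple x (- y) z = - triple x y z"
  using add_middle[of x y "- y" z] by (simp add: zero_middle eq_neg_iff_add_eq_0 add.commute)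

lemma minus_right: "triple x y (- z) = - triple x y z"
  using add_right[of x y z "- z"] by (simp add: zero_right eq_neg_iff_add_eq_0 add.commute)

lemma diff_left: "triple (x - x') y z = triple x y z - triple x' y z"
  using add_left[of x "- x'" y z] by (simp add: minus_left)

lemma diff_middle: "triple x (y - y') z = triple x y z - triple x y' z"
  using add_middle[of x y "- y'" z] by (simp add: minus_middle)

lemma diff_right: "triple x y (z - z') = triple x y z - triple x y z'"
  using add_right[of x y z "- z'"] by (simp add: minus_right)

lemmas triple_additive = add_left add_middle add_right diff_left diff_middle diff_right
  minus_left minus_middle minus_right

lemma double_cancel:
  fixes x :: 'a
  shows "x + x = 0 \<longleftrightarrow> x = 0"
proof
  assume "x + x = 0"
  then have "cscale 2 x = 0"
    using scale_left_distrib[of 1 1 x] by simp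
  then show "x = 0" by simp
qed simp

lemma thrice_cancel:
  fixes x :: 'a
  shows "x + x + x = 0 \<longleftrightarrow> x = 0"
proof
  assume "x + x + x = 0"
  then have "cscale 3 x = 0"
    using scale_left_distrib[of 2 1 x] scale_left_distrib[of 1 1 x] by simp
  then show "x = 0" by simp
qed simp

lemma tripotent_scale:
  assumes "cmod \<alpha> = 1" and "tripotent triple u"
  shows "tripotent triple (cscale \<alpha> u)"
proof -
  have "\<alpha> * cnj \<alpha> = 1"
    using assms(1) by (simp add: complex_norm_square[symmetric])
  then show ?thesis
    using assms(2)
    by (simp add: tripotent_def scale_left scale_middle scale_right mult.assoc[symmetric])
qed

subsection \<open>Peirce calculus\<close>

text \<open>Expanding \<open>{e, e, {e, x, e}}\<close> and \<open>{e, x, {e, e, e}}\<close> gives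
  two linear equations in \<open>q\<close>, \<open>d\<close> and \<open>r\<close>; eliminating
  \<open>r\<close> leaves 3(d - q) = 0.\<close>

lemma D_Q:
  assumes tripotent: "triple e e e = e"
  shows "triple e e (triple e x e) = triple e x e"
proof -
  define q where "q = triple e x e"
  define d where "d = triple e e q"
  define r where "r = triple e (triple e e x) e"
  have 1: "d = q - r + q"
    using main_identity[of e e e x e] by (simp add: d_def q_def r_def tripotent)
  have 2: "q = d - r + d"
    using main_identity[of e x e e e]
    by (simp add: d_def q_def r_def tripotent triple_commute[of "triple e x e" e e]
        triple_commute[of x e e])
  have r: "r = q + q - d"
    using 1 by (simp add: algebra_simps)
  have "(d - q) + (d - q) + (d - q) = (d - r + d) - q"
    unfolding r by (simp add: algebra_simps)
  also have "\<dots> = 0"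
    by (simp only: 2[symmetric] diff_self)
  finally have "(d - q) + (d - q) + (d - q) = 0" .
  then have "d = q"
    by (simp only: thrice_cancel) simp
  then show ?thesis
    by (simp add: d_def q_def)
qed

lemma Q_Q:
  assumes tripotent: "triple e e e = e"
  shows "triple e (triple e x e) e =
     triple e e (triple e e x) + triple e e (triple e e x) - triple e e x"
  using main_identity[of x e e e e]
  by (simp add: tripotent triple_commute[of "triple e e x" e e]
      triple_commute[of x e e] algebra_simps)

lemma Q_Q_peirce2:
  assumes "triple e e e = e" and "triple e e x = x"
  shows "triple e (triple e x e) e = x"
  using Q_Q[of e x] assms by simp

text \<open>The cubic \<open>D(D - 1)(2D - 1) = 0\<close> in terms of \<open>R = D - 1\<close>.\<close>

lemma peirce_cubic:
  assumes tripotent: "triple e e e = e"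
    and R: "\<And>x. R x = triple e e x - x"
  shows "R (R (R x)) + R (R (R x)) + R (R x) + R (R x) + R (R x) + R x = 0"
proof -
  define d1 d2 d3 where "d1 = triple e e x" and "d2 = triple e e d1" and "d3 = triple e e d2"
  \<comment> \<open>\<open>D_Q\<close> at \<open>{e, x, e}\<close> says that D fixes the range of Q
    twice applied, and \<open>Q_Q\<close> turns this into a polynomial relation in D.\<close>
  have "d3 + d3 - d2 = d2 + d2 - d1"
    using D_Q[OF tripotent, of "triple e x e"]
    by (simp add: Q_Q[OF tripotent] triple_additive d1_def d2_def d3_def)
  then have "d3 + d3 + d1 = d2 + d2 + d2"
    by (simp add: algebra_simps)
  then show ?thesis
    by (simp add: R triple_additive d1_def[symmetric]
        d2_def[symmetric] d3_def[symmetric] algebra_simps)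
qed

text \<open>\<open>R\<close> anticommutes with \<open>Q\<close>. Hence the cubic at
  \<open>Q x\<close> and the image under \<open>Q\<close> of the cubic at \<open>x\<close> differ by
  the sign of the odd powers of \<open>R\<close>, and their sum isolates the quadratic term.\<close>

lemma peirce2_Q_into:
  assumes tripotent: "triple e e e = e" and v: "triple e e v = v"
  shows "triple e e (triple v x v) = triple v x v"
proof -
  define R where "R = (\<lambda>x. triple e e x - x)"
  define Q where "Q = (\<lambda>x. triple v x v)"
  have cubic: "R (R (R x)) + R (R (R x)) + R (R x) + R (R x) + R (R x) + R x = 0" for x
    by (rule peirce_cubic[OF tripotent]) (simp add: R_def)
  have Q_add: "Q (x + y) = Q x + Q y" for x y
    by (simp add: Q_def triple_additive)
  have R_minus: "R (- x) = - R x" for x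
    by (simp add: R_def triple_additive)
  have RQ: "R (Q x) = - Q (R x)" for x
    using main_identity[of e e v x v] v by (simp add: R_def Q_def triple_additive)
  have Q0: "Q 0 = 0"
    by (simp add: Q_def zero_middle)
  have plus: "Q (R (R (R x))) + Q (R (R (R x))) + Q (R (R x)) + Q (R (R x)) + Q (R (R x)) +
      Q (R x) = 0" for x
    using arg_cong[OF cubic[of x], of Q] by (simp only: Q_add Q0)
  have QRR: "Q (R (R x)) = 0" for x
  proof -
    define a b c where "a = Q (R x)" and "b = Q (R (R x))" and "c = Q (R (R (R x)))"
    have "c + c + b + b + b + a = 0"
      using plus[of x] by (simp only: a_def b_def c_def)
    moreover have "- c - c + b + b + b - a = 0"
      using cubic[of "Q x"] by (simp add: RQ R_minus a_def b_def c_def)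
    moreover have "(b + b + b) + (b + b + b) = (c + c + b + b + b + a) + (- c - c + b + b + b - a)"
      by (simp add: algebra_simps)
    ultimately have "(b + b + b) + (b + b + b) = 0"
      by simp
    then show ?thesis
      by (simp only: double_cancel thrice_cancel b_def)
  qed
  \<comment> \<open>\<open>QRR\<close> at \<open>x\<close> and at \<open>R x\<close> kills all but
    the linear term.\<close>
  have "Q (R x) = 0"
    using plus[of x] by (simp add: QRR)
  then have "R (Q x) = 0"
    by (simp add: RQ)
  then show ?thesis
    by (simp add: R_def Q_def)
qed

text \<open>In the Jordan algebra \<open>E\<^sub>2(e)\<close> with product \<open>{x, e, y}\<close> and involution \<open>{e, x, e}\<close>, the element
  \<open>p\<close> is \<open>w\<^sup>2\<close>; all the identities below are instances of \<open>w\<^sup>3 = w = w\<^sup>*\<close>.\<close>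

lemma tripotent_square:
  assumes tripotent: "triple e e e = e" and w: "triple w w w = w" and sa: "triple e w e = w"
  defines "p \<equiv> triple w w e"
  shows "triple p p p = p"
proof -
  note c = triple_commute
  have eew: "triple e e w = w"
    using D_Q[OF tripotent, of w] sa by simp
  have wee: "triple w e e = w"
    using eew c by metis
  have eep: "triple e e p = p"
    using main_identity[of e e w w e] by (simp add: p_def eew tripotent)
  have eww: "triple e w w = p"
    unfolding p_def by (rule c)
  have epe: "triple e p e = p"
    using main_identity[of w w e e e] c[of p e e] eep by (simp add: p_def[symmetric] tripotent)
  have wew: "triple w e w = p"
    using main_identity[of w e e w e] c[of e w w] epe by (simp add: sa wee eww p_def[symmetric])
  have wwp: "triple w w p = p"
    using D_Q[OF w, of e] by (simp add: wew)
  have wpw: "triple w p w = p"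
    using main_identity[of w w w e w] by (simp add: w wew wwp p_def[symmetric])
  have pww: "triple p w w = p"
    using wwp c by metis
  have wpe: "triple w p e = w" and wep: "triple w e p = w" and pwe: "triple p w e = w"
  proof -
    \<comment> \<open>The unknown \<open>{w, e, p}\<close> occurs on both sides, and the middle term
      is \<open>{w, {e, w, e}, w} = w\<close>, so the equation can be solved for it.\<close>
    have 1: "triple w e p = triple w e p + triple w e p - w"
      using main_identity[of w e w e w] c[of p e w] by (simp add: wew w sa)
    then show wep: "triple w e p = w"
      by (simp add: algebra_simps)
    show wpe: "triple w p e = w"
      using main_identity[of w w w e e] by (simp add: w wee wep p_def[symmetric])
    show "triple p w e = w"
      using main_identity[of w e w w e] by (simp add: wew wee eww w wep wpe p_def[symmetric])
  qed
  have ppw: "triple p p w = w"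
    using main_identity[of w p w w e] c[of w p p] by (simp add: wpw pww wpe pwe w p_def[symmetric])
  have ppe: "triple p p e = p"
    using main_identity[of e p w w e] c[of e p p] c[of e p w] c[of p e w]
    by (simp add: wpe wep epe wwp p_def[symmetric])
  \<comment> \<open>Expanding \<open>{p, p, {w, w, e}}\<close>, the first two terms cancel because
    \<open>{p, p, w} = w\<close>.\<close>
  show ?thesis
    using main_identity[of p p w w e] by (simp add: ppw ppe wwp p_def[symmetric])
qed

subsection \<open>Relations between tripotents\<close>

text \<open>The map \<open>{v, _, v}\<close> squares to the identity on the Peirce space of
  \<open>v\<close>, so \<open>u\<close> lies in its range, which \<open>peirce2_Q_into\<close>
  places in the Peirce space of \<open>e\<close>.\<close>

lemma peirce2_trans:
  assumes "tripotent triple e" "tripotent triple v" "tri_le_2 triple v e" "tri_le_2 triple u v"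
  shows "tri_le_2 triple u e"
proof -
  have "triple v (triple v u v) v = u"
    using Q_Q_peirce2 assms by (simp add: tripotent_def tri_le_2_def peirce2_def)
  then show ?thesis
    using peirce2_Q_into[of e v "triple v u v"] assms
    by (simp add: tripotent_def tri_le_2_def peirce2_def)
qed

lemma tri_chain_mono:
  assumes "tri_chain triple R u e"
    and "\<And>x y. tripotent triple x \<Longrightarrow> tripotent triple y \<Longrightarrow> R x y \<Longrightarrow> R' x y"
  shows "tri_chain triple R' u e"
proof -
  obtain k and v :: "nat \<Rightarrow> 'a" where v: "v 0 = e" "v k = u" "\<forall>j\<le>k. tripotent triple (v j)"
    "\<forall>j\<in>{1..k}. R (v j) (v (j - 1))"
    using assms(1) unfolding tri_chain_def by blast
  have "R' (v j) (v (j - 1))" if "j \<in> {1..k}" for j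
    using that v by (intro assms(2)) auto
  with v show ?thesis
    unfolding tri_chain_def by blast
qed

lemma tri_chain_single:
  assumes "tripotent triple u" "tripotent triple e" "R u e"
  shows "tri_chain triple R u e"
  unfolding tri_chain_def
  by (rule exI[of _ 1], rule exI[of _ "\<lambda>j. if j = 0 then e else u"]) (use assms in auto)

text \<open>Orthogonality lets an outer \<open>e\<close> be replaced by \<open>u\<close> whenever
  the middle entry is \<open>u\<close>; doing so on both sides turns \<open>{e, u, e}\<close> into
  \<open>{u, u, u}\<close>.\<close>

lemma tri_le_imp_tri_le_h:
  assumes "tripotent triple u" and "tri_le triple u e"
  shows "tri_le_h triple u e"
proof -
  have orth: "triple (e - u) u x = 0" for x
    using assms(2) by (simp add: tri_le_def tri_orthogonal_def)
  have e: "triple e u x = triple u u x" for x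
    using orth[of x] by (simp add: diff_left)
  have "triple e u e = triple u u e"
    by (rule e)
  also have "\<dots> = triple e u u"
    by (rule triple_commute)
  also have "\<dots> = u"
    using assms(1) by (simp add: e tripotent_def)
  finally show ?thesis
    by (simp add: tri_le_h_def)
qed

lemma tri_le_r_imp_tri_le_c: "tri_le_r triple u e \<Longrightarrow> tri_le_c cscale triple u e"
  unfolding tri_le_r_def tri_le_c_def
  by (metis norm_minus_cancel norm_one scale_minus_left scale_one)

lemma tri_le_r_imp_tri_le_h:
  assumes "tripotent triple u" and "tri_le_r triple u e"
  shows "tri_le_h triple u e"
  using assms(2) unfolding tri_le_r_def
proof
  assume "tri_le triple (- u) e"
  moreover have "tripotent triple (- u)"
    using assms(1) by (simp add: tripotent_def minus_left minus_middle minus_right)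
  ultimately have "tri_le_h triple (- u) e"
    by (rule tri_le_imp_tri_le_h[rotated])
  then show ?thesis
    by (simp add: tri_le_h_def minus_middle)
qed (rule tri_le_imp_tri_le_h[OF assms(1)])

lemma tri_le_c_imp_tri_le_hc:
  assumes "tripotent triple u" and "tri_le_c cscale triple u e"
  shows "tri_le_hc cscale triple u e"
  using assms tri_le_imp_tri_le_h tripotent_scale
  unfolding tri_le_c_def tri_le_hc_def by blast

lemma tri_le_h_imp_tri_le_hc: "tri_le_h triple u e \<Longrightarrow> tri_le_hc cscale triple u e"
  unfolding tri_le_hc_def by (metis norm_one scale_one)

text \<open>For \<open>w = cscale \<alpha> u\<close> this is \<open>D_Q\<close> and
  \<open>tripotent_square\<close>; the unit divides out of \<open>{e, e, w} = w\<close> and meets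
  its conjugate in \<open>{w, w, e}\<close>.\<close>

lemma tri_le_hc_imp_tri_le_n:
  assumes u: "tripotent triple u" and e: "tripotent triple e" and "tri_le_hc cscale triple u e"
  shows "tri_le_n triple u e"
proof -
  obtain \<alpha> where \<alpha>: "cmod \<alpha> = 1" and h: "triple e (cscale \<alpha> u) e = cscale \<alpha> u"
    using assms(3) by (auto simp: tri_le_hc_def tri_le_h_def)
  define w where "w = cscale \<alpha> u"
  have e': "triple e e e = e" and w: "triple w w w = w"
    using tripotent_scale[OF \<alpha> u] e by (simp_all add: w_def tripotent_def)
  have "triple e e w = w"
    using D_Q[OF e', of w] h by (simp add: w_def)
  then have "cscale \<alpha> (triple e e u) = cscale \<alpha> u"
    by (simp add: w_def scale_right)
  moreover have "\<alpha> \<noteq> 0"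
    using \<alpha> by auto
  ultimately have "triple e e u = u"
    by simp
  moreover have "\<alpha> * cnj \<alpha> = 1"
    using \<alpha> by (simp add: complex_norm_square[symmetric])
  then have "triple w w e = triple u u e"
    by (simp add: w_def scale_left scale_middle mult.commute)
  then have "tripotent triple (triple u u e)"
    using tripotent_square[OF e' w] h by (simp add: w_def tripotent_def)
  ultimately show ?thesis
    by (simp add: tri_le_n_def)
qed

lemma tri_le_ht_imp_tri_le_hct: "tri_le_ht triple u e \<Longrightarrow> tri_le_hct cscale triple u e"
  unfolding tri_le_ht_def tri_le_hct_def
  by (erule tri_chain_mono) (rule tri_le_h_imp_tri_le_hc)

lemma tri_le_hct_imp_tri_le_nt: "tri_le_hct cscale triple u e \<Longrightarrow> tri_le_nt triple u e"
  unfolding tri_le_hct_def tri_le_nt_def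
  by (erule tri_chain_mono) (rule tri_le_hc_imp_tri_le_n)

lemma tri_le_nt_imp_tri_le_2:
  assumes "tri_le_nt triple u e"
  shows "tri_le_2 triple u e"
proof -
  obtain k and v :: "nat \<Rightarrow> 'a" where v: "v 0 = e" "v k = u" "\<forall>j\<le>k. tripotent triple (v j)"
    "\<forall>j\<in>{1..k}. tri_le_n triple (v j) (v (j - 1))"
    using assms unfolding tri_le_nt_def tri_chain_def by blast
  have "j \<le> k \<Longrightarrow> tri_le_2 triple (v j) e" for j
  proof (induction j)
    \<comment> \<open>This also covers the empty chain: a tripotent lies in its own Peirce
      space.\<close>
    case 0
    have "tripotent triple (v 0)"
      using v(3) by simp
    then show ?case
      using v(1) by (simp add: tri_le_2_def peirce2_def tripotent_def)
  next
    case (Suc j)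
    have "tri_le_n triple (v (Suc j)) (v j)"
      using bspec[OF v(4), of "Suc j"] Suc.prems by simp
    then have "v (Suc j) = triple (v j) (v j) (v (Suc j))"
      by (simp only: tri_le_n_def)
    from this[symmetric] have step: "tri_le_2 triple (v (Suc j)) (v j)"
      by (simp only: tri_le_2_def peirce2_def mem_Collect_eq)
    have "tripotent triple (v 0)" and vj: "tripotent triple (v j)"
      using v(3) Suc.prems by simp_all
    then have "tripotent triple e"
      by (simp only: v(1))
    moreover have "tri_le_2 triple (v j) e"
      using Suc.IH Suc.prems by simp
    ultimately show ?case
      by (rule peirce2_trans[OF _ vj _ step])
  qed
  then have "tri_le_2 triple (v k) e"
    by simp
  then show ?thesis
    by (simp only: v(2))
qed

lemma tri_le_implications:
  assumes e: "tripotent triple e" and u: "tripotent triple u"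
  shows "(tri_le triple u e \<longrightarrow> tri_le_r triple u e) \<and>
    (tri_le_r triple u e \<longrightarrow> tri_le_c cscale triple u e) \<and>
    (tri_le_h triple u e \<longrightarrow> tri_le_hc cscale triple u e) \<and>
    (tri_le_hc cscale triple u e \<longrightarrow> tri_le_n triple u e) \<and>
    (tri_le_ht triple u e \<longrightarrow> tri_le_hct cscale triple u e) \<and>
    (tri_le_hct cscale triple u e \<longrightarrow> tri_le_nt triple u e) \<and>
    (tri_le_nt triple u e \<longrightarrow> tri_le_2 triple u e) \<and>
    (tri_le_r triple u e \<longrightarrow> tri_le_h triple u e) \<and>
    (tri_le_c cscale triple u e \<longrightarrow> tri_le_hc cscale triple u e) \<and>
    (tri_le_h triple u e \<longrightarrow> tri_le_ht triple u e) \<and>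
    (tri_le_hc cscale triple u e \<longrightarrow> tri_le_hct cscale triple u e) \<and>
    (tri_le_n triple u e \<longrightarrow> tri_le_nt triple u e)"
  using tri_le_r_imp_tri_le_c tri_le_h_imp_tri_le_hc tri_le_hc_imp_tri_le_n[OF u e]
    tri_le_ht_imp_tri_le_hct tri_le_hct_imp_tri_le_nt tri_le_nt_imp_tri_le_2
    tri_le_r_imp_tri_le_h[OF u] tri_le_c_imp_tri_le_hc[OF u]
    tri_chain_single[of u e "tri_le_h triple", OF u e]
    tri_chain_single[of u e "tri_le_hc cscale triple", OF u e]
    tri_chain_single[of u e "tri_le_n triple", OF u e]
  unfolding tri_le_ht_def tri_le_hct_def tri_le_nt_def tri_le_r_def
  by simp

end

sublocale jbstar_triple \<subseteq> jordan_triple_system cscale triple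
  by (intro jordan_triple_system.intro jordan_triple_system_axioms.intro)
    (rule vector_space_axioms triple_sym triple_linear triple_add_middle triple_scale_middle
      jordan_identity)+

section \<open>Jordan *-algebras\<close>

locale jordan_star_algebra = vector_space cscale
  for cscale :: "complex \<Rightarrow> 'a::ab_group_add \<Rightarrow> 'a" +
  fixes mult :: "'a \<Rightarrow> 'a \<Rightarrow> 'a" (infixl "\<odot>" 70)
    and star :: "'a \<Rightarrow> 'a"
  assumes commute: "x \<odot> y = y \<odot> x"
    and linear_mult: "Vector_Spaces.linear cscale cscale (\<lambda>x. x \<odot> y)"
    and jordan: "(x \<odot> y) \<odot> (x \<odot> x) = x \<odot> (y \<odot> (x \<odot> x))"
    and star_plus: "star (x + y) = star x + star y"
    and star_cscale: "star (cscale c x) = cscale (cnj c) (star x)"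
    and star_involutive: "star (star x) = x"
    and star_mult: "star (x \<odot> y) = star y \<odot> star x"
begin

lemma mult_add_left: "(x + x') \<odot> y = x \<odot> y + x' \<odot> y"
  using linear_mult[of y] by (simp add: Vector_Spaces.linear_iff)

lemma scale_mult_left: "cscale c x \<odot> y = cscale c (x \<odot> y)"
  using linear_mult[of y] by (simp add: Vector_Spaces.linear_iff)

lemma mult_add_right: "y \<odot> (x + x') = y \<odot> x + y \<odot> x'"
  by (metis commute mult_add_left)

lemma scale_mult_right: "y \<odot> cscale c x = cscale c (y \<odot> x)"
  by (metis commute scale_mult_left)

lemma mult_zero_left: "0 \<odot> y = 0"
  using mult_add_left[of 0 0 y] by simp

lemma mult_diff_left: "(x - x') \<odot> y = x \<odot> y - x' \<odot> y"
  by (metis add_diff_cancel_right' diff_add_cancel mult_add_left)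

lemma mult_diff_right: "y \<odot> (x - x') = y \<odot> x - y \<odot> x'"
  by (metis commute mult_diff_left)

lemma star_diff: "star (x - y) = star x - star y"
  by (metis add_diff_cancel_right' diff_add_cancel star_plus)

section \<open>Linearised Jordan identity and inner derivations\<close>

lemma half_unique:
  fixes x y :: 'a
  assumes "x + x = y + y"
  shows "x = y"
proof -
  have "cscale 2 x = cscale 2 y"
    using assms scale_left_distrib[of 1 1 x] scale_left_distrib[of 1 1 y] by simp
  then show ?thesis by simp
qed

text \<open>Polarisation: inclusion-exclusion over sums of \<open>x\<close>, \<open>y\<close>,
  \<open>z\<close> extracts the trilinear part of the cubic map \<open>F\<close>, where
  commutativity makes each term occur twice.\<close>

lemma jordan_linearised:
  "(x \<odot> b) \<odot> (y \<odot> z) + (y \<odot> b) \<odot> (x \<odot> z) + (z \<odot> b) \<odot> (x \<odot> y) =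
   x \<odot> (b \<odot> (y \<odot> z)) + y \<odot> (b \<odot> (x \<odot> z)) + z \<odot> (b \<odot> (x \<odot> y))"
proof -
  define F where "F x = (x \<odot> b) \<odot> (x \<odot> x) - x \<odot> (b \<odot> (x \<odot> x))" for x
  have F: "F x = 0" for x
    by (simp add: F_def jordan)
  define l where "l = (x \<odot> b) \<odot> (y \<odot> z) + (y \<odot> b) \<odot> (x \<odot> z) + (z \<odot> b) \<odot> (x \<odot> y)"
  define r where "r = x \<odot> (b \<odot> (y \<odot> z)) + y \<odot> (b \<odot> (x \<odot> z)) + z \<odot> (b \<odot> (x \<odot> y))"
  have "(l + l) - (r + r) =
      F (x + y + z) - F (x + y) - F (x + z) - F (y + z) + F x + F y + F z"
    by (simp add: F_def l_def r_def mult_add_left mult_add_right commute algebra_simps)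
  then have "l + l = r + r"
    by (simp add: F)
  then show ?thesis
    unfolding l_def r_def by (rule half_unique)
qed

definition comm :: "'a \<Rightarrow> 'a \<Rightarrow> 'a \<Rightarrow> 'a" where
  "comm a b c = a \<odot> (b \<odot> c) - b \<odot> (a \<odot> c)"

text \<open>The linearised identity regrouped into commutators of multiplication operators acting on
  \<open>b\<close>.\<close>

lemma comm_cyclic: "comm x (y \<odot> z) b + comm y (x \<odot> z) b + comm z (x \<odot> y) b = 0"
  using jordan_linearised[of x b y z]
  by (simp add: comm_def commute algebra_simps)

lemma comm_additive:
  "comm a b (x + y) = comm a b x + comm a b y" "comm a b (x - y) = comm a b x - comm a b y"
  "comm (x + y) a b = comm x a b + comm y a b" "comm (x - y) a b = comm x a b - comm y a b"
  "comm a (x + y) b = comm a x b + comm a y b" "comm a (x - y) b = comm a x b - comm a y b"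
  by (simp_all add: comm_def mult_add_left mult_add_right mult_diff_left mult_diff_right algebra_simps)

text \<open>The left-hand side of the linearised Jordan identity is symmetric in three of its variables,
  hence so is its right-hand side.\<close>

lemma comm_derivation: "comm a b (x \<odot> y) = comm a b x \<odot> y + x \<odot> comm a b y"
proof -
  have "b \<odot> (a \<odot> (x \<odot> y)) + x \<odot> (a \<odot> (b \<odot> y)) + y \<odot> (a \<odot> (b \<odot> x)) =
      a \<odot> (b \<odot> (x \<odot> y)) + x \<odot> (b \<odot> (a \<odot> y)) + y \<odot> (b \<odot> (a \<odot> x))"
    unfolding jordan_linearised[symmetric]
    by (simp add: commute add_ac)
  then show ?thesis
    by (simp add: comm_def mult_diff_left mult_diff_right commute algebra_simps)
qed

section \<open>Triple product of a Jordan *-algebra\<close>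

definition prod3 :: "'a \<Rightarrow> 'a \<Rightarrow> 'a \<Rightarrow> 'a" where
  "prod3 x y z = (x \<odot> y) \<odot> z + comm x y z"

lemma prod3_additive:
  "prod3 (x + y) a b = prod3 x a b + prod3 y a b" "prod3 (x - y) a b = prod3 x a b - prod3 y a b"
  "prod3 a (x + y) b = prod3 a x b + prod3 a y b" "prod3 a (x - y) b = prod3 a x b - prod3 a y b"
  "prod3 a b (x + y) = prod3 a b x + prod3 a b y" "prod3 a b (x - y) = prod3 a b x - prod3 a b y"
  by (simp_all add: prod3_def comm_additive mult_add_left mult_add_right mult_diff_left
      mult_diff_right algebra_simps)

lemma comm_prod3:
  "comm x y (prod3 a b c) =
     prod3 (comm x y a) b c + prod3 a (comm x y b) c + prod3 a b (comm x y c)"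
  by (simp add: prod3_def comm_def[of a] comm_def[of "comm x y a"] comm_def[of a "comm x y b"]
      comm_additive comm_derivation mult_add_left mult_add_right algebra_simps)

text \<open>\<open>comm_cyclic\<close> treats the first summand of \<open>prod3\<close> and the
  derivation rule the second; the leftover \<open>comm a b w \<odot> c\<close> is the change in the
  products \<open>a \<odot> b\<close>.\<close>

lemma mult_prod3:
  "w \<odot> prod3 a b c = prod3 (w \<odot> a) b c - prod3 a (w \<odot> b) c + prod3 a b (w \<odot> c)"
proof -
  have 1: "w \<odot> ((a \<odot> b) \<odot> c) = (a \<odot> b) \<odot> (w \<odot> c) - comm a (w \<odot> b) c + comm (w \<odot> a) b c"
    using comm_cyclic[of w a b c] by (simp add: comm_def algebra_simps)
  have 2: "w \<odot> comm a b c = comm a b (w \<odot> c) - comm a b w \<odot> c"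
    by (simp add: comm_derivation)
  have 3: "comm a b w = a \<odot> (w \<odot> b) - (w \<odot> a) \<odot> b"
    by (simp add: comm_def commute)
  show ?thesis
    unfolding prod3_def mult_add_right 1 2 3 mult_diff_left by (simp add: algebra_simps)
qed

text \<open>\<open>prod3 x y\<close> is multiplication by \<open>w\<close> plus the derivation
  \<open>comm x y\<close>, and swapping \<open>x\<close> and \<open>y\<close> flips only the
  derivation. This flip reconciles the minus sign in \<open>mult_prod3\<close> with the plus sign in
  \<open>comm_prod3\<close>.\<close>

lemma prod3_identity:
  "prod3 x y (prod3 a b c) =
     prod3 (prod3 x y a) b c - prod3 a (prod3 y x b) c + prod3 a b (prod3 x y c)"
proof -
  define w where "w = x \<odot> y"
  have xy: "prod3 x y z = w \<odot> z + comm x y z" for z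
    by (simp add: prod3_def w_def)
  have yx: "prod3 y x z = w \<odot> z - comm x y z" for z
    by (simp add: prod3_def w_def commute comm_def)
  show ?thesis
    unfolding xy yx
    by (simp add: mult_prod3 comm_prod3 prod3_additive algebra_simps)
qed

lemma jordan_triple_eq: "jordan_triple (\<odot>) star x y z = prod3 x (star y) z"
  by (simp add: jordan_triple_def prod3_def comm_def commute algebra_simps)

lemma star_prod3: "star (prod3 x y z) = prod3 (star x) (star y) (star z)"
  by (simp add: prod3_def comm_def star_plus star_diff star_mult commute algebra_simps)

sublocale triple: jordan_triple_system cscale "jordan_triple (\<odot>) star"
proof (intro jordan_triple_system.intro jordan_triple_system_axioms.intro vector_space_axioms)
  fix x y y' z a b c and \<gamma>
  show "jordan_triple (\<odot>) star x y z = jordan_triple (\<odot>) star z y x"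
    by (simp add: jordan_triple_def commute algebra_simps)
  show "Vector_Spaces.linear cscale cscale (\<lambda>x. jordan_triple (\<odot>) star x y z)"
    unfolding Vector_Spaces.linear_iff
    by (simp add: vector_space_axioms jordan_triple_def mult_add_left scale_mult_left
        scale_right_distrib scale_right_diff_distrib algebra_simps)
  show "jordan_triple (\<odot>) star x (y + y') z =
      jordan_triple (\<odot>) star x y z + jordan_triple (\<odot>) star x y' z"
    by (simp add: jordan_triple_eq star_plus prod3_additive)
  show "jordan_triple (\<odot>) star x (cscale \<gamma> y) z = cscale (cnj \<gamma>) (jordan_triple (\<odot>) star x y z)"
    by (simp add: jordan_triple_def star_cscale scale_mult_left scale_mult_right
        scale_right_distrib scale_right_diff_distrib)
  show "jordan_triple (\<odot>) star x y (jordan_triple (\<odot>) star a b c) =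
      jordan_triple (\<odot>) star (jordan_triple (\<odot>) star x y a) b c -
      jordan_triple (\<odot>) star a (jordan_triple (\<odot>) star y x b) c +
      jordan_triple (\<odot>) star a b (jordan_triple (\<odot>) star x y c)"
    by (simp add: jordan_triple_eq star_prod3 star_involutive prod3_identity[of x])
qed

section \<open>Projections\<close>

lemma tripotent_projection:
  assumes "jprojection (\<odot>) star p"
  shows "tripotent (jordan_triple (\<odot>) star) p"
  using assms by (simp add: jprojection_def tripotent_def jordan_triple_def)

text \<open>In \<open>comm_cyclic\<close> for \<open>f\<close>, \<open>u\<close>, \<open>u\<close>,
  two terms contain \<open>f \<odot> u = 0\<close>, and \<open>u \<odot> u = u\<close> reduces the
  third to \<open>comm f u x\<close>.\<close>

lemma comm_orthogonal_projection:
  assumes "u \<odot> u = u" and "f \<odot> u = 0"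
  shows "comm f u x = 0"
  using comm_cyclic[of f u u x] assms mult_add_right[of u 0 0] by (simp add: comm_def mult_zero_left)

lemma projection_tri_le_2_imp_tri_le:
  assumes e: "jprojection (\<odot>) star e" and u: "jprojection (\<odot>) star u"
    and "tri_le_2 (jordan_triple (\<odot>) star) u e"
  shows "tri_le (jordan_triple (\<odot>) star) u e"
proof -
  have ee: "e \<odot> e = e" "star e = e" and uu: "u \<odot> u = u" "star u = u"
    using e u by (simp_all add: jprojection_def)
  \<comment> \<open>For a projection \<open>e\<close> the last two terms of \<open>{e, e, u}\<close>
    cancel, leaving \<open>e \<odot> u\<close>.\<close>
  have eu: "e \<odot> u = u"
    using assms(3) by (simp add: tri_le_2_def peirce2_def jordan_triple_def ee commute)
  have f: "jprojection (\<odot>) star (e - u)"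
    by (simp add: jprojection_def star_diff mult_diff_left mult_diff_right ee uu eu commute)
  have fu: "(e - u) \<odot> u = 0"
    by (simp add: mult_diff_left uu eu)
  have "tri_orthogonal (jordan_triple (\<odot>) star) (e - u) u"
    using comm_orthogonal_projection[OF uu(1) fu]
    by (simp add: tri_orthogonal_def jordan_triple_eq prod3_def uu fu mult_zero_left)
  then show ?thesis
    using tripotent_projection[OF f] by (simp add: tri_le_def)
qed

end

sublocale jbstar_algebra \<subseteq> jordan_star_algebra cscale jmult star
  by (intro jordan_star_algebra.intro jordan_star_algebra_axioms.intro)
    (rule vector_space_axioms jmult_commute jmult_linear jmult_jordan star_add
      star_scale star_star star_jmult)+

theorem proposition2p18:
  fixes cscale :: "complex \<Rightarrow> 'a::banach \<Rightarrow> 'a"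
    and T :: "'a \<Rightarrow> 'a \<Rightarrow> 'a \<Rightarrow> 'a"
    and jmult :: "'a \<Rightarrow> 'a \<Rightarrow> 'a"
    and star :: "'a \<Rightarrow> 'a"
    and e u :: 'a
  shows
    "(jbstar_triple cscale T \<and> tripotent T e \<and> tripotent T u \<longrightarrow>
        (tri_le T u e \<longrightarrow> tri_le_r T u e) \<and>
        (tri_le_r T u e \<longrightarrow> tri_le_c cscale T u e) \<and>
        (tri_le_h T u e \<longrightarrow> tri_le_hc cscale T u e) \<and>
        (tri_le_hc cscale T u e \<longrightarrow> tri_le_n T u e) \<and>
        (tri_le_ht T u e \<longrightarrow> tri_le_hct cscale T u e) \<and>
        (tri_le_hct cscale T u e \<longrightarrow> tri_le_nt T u e) \<and>
        (tri_le_nt T u e \<longrightarrow> tri_le_2 T u e) \<and>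
        (tri_le_r T u e \<longrightarrow> tri_le_h T u e) \<and>
        (tri_le_c cscale T u e \<longrightarrow> tri_le_hc cscale T u e) \<and>
        (tri_le_h T u e \<longrightarrow> tri_le_ht T u e) \<and>
        (tri_le_hc cscale T u e \<longrightarrow> tri_le_hct cscale T u e) \<and>
        (tri_le_n T u e \<longrightarrow> tri_le_nt T u e)) \<and>
     (jbstar_algebra cscale jmult star \<and> T = jordan_triple jmult star \<and>
      jprojection jmult star e \<and> jprojection jmult star u \<longrightarrow>
        (tri_le T u e \<longleftrightarrow> tri_le_r T u e) \<and>
        (tri_le T u e \<longleftrightarrow> tri_le_c cscale T u e) \<and>
        (tri_le T u e \<longleftrightarrow> tri_le_h T u e) \<and>
        (tri_le T u e \<longleftrightarrow> tri_le_hc cscale T u e) \<and>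
        (tri_le T u e \<longleftrightarrow> tri_le_n T u e) \<and>
        (tri_le T u e \<longleftrightarrow> tri_le_ht T u e) \<and>
        (tri_le T u e \<longleftrightarrow> tri_le_hct cscale T u e) \<and>
        (tri_le T u e \<longleftrightarrow> tri_le_nt T u e) \<and>
        (tri_le T u e \<longleftrightarrow> tri_le_2 T u e))"
  (is "(_ \<longrightarrow> ?A) \<and> (_ \<longrightarrow> ?B)")
proof (rule conjI; rule impI; elim conjE)
  assume "jbstar_triple cscale T" and e: "tripotent T e" and u: "tripotent T u"
  then interpret jbstar_triple cscale T
    by simp
  show ?A
    by (rule tri_le_implications[OF e u])
next
  assume "jbstar_algebra cscale jmult star" and T: "T = jordan_triple jmult star"
    and e: "jprojection jmult star e" and u: "jprojection jmult star u"
  then interpret jbstar_algebra cscale jmult star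
    by simp
  \<comment> \<open>By the general implications each relation follows from \<open>tri_le\<close> and
    implies \<open>tri_le_2\<close>, so one arrow back closes every cycle.\<close>
  show ?B
    using triple.tri_le_implications[OF tripotent_projection[OF e] tripotent_projection[OF u],
        folded T]
      projection_tri_le_2_imp_tri_le[OF e u, folded T]
    by blast
qed

end
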